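(* Assume: (1) $u^\dagger,\lambda^\dagger\in H^p(\Omega)$ with $p>\max\{d/2+1,4\}$; (2) in the case of the inverse potential problem ($\lambda=b$), there is $c_0$ with $|u^\dagger|\ge c_0>0$ a.e. in $\Omega$; (3) there exist finite constants $M_u,M_\lambda>0$, depending only on $\omega_{\max}$, the initial loss $\bar{\mathcal R}_u^{(0)}$, $\|u^\dagger\|_{H^p(\Omega)}$ and $\|\lambda^\dagger\|_{H^p(\Omega)}$, such that the iterates $\{u_k,\lambda_k\}_{k\ge0}$ of the alternating algorithm satisfy $\|u_k\|_{W^{1,\infty}(\Omega)}\le M_u$ and $\|\lambda_k\|_{W^{1,\infty}(\Omega)}\le M_\lambda$ for all $k\ge0$. Then the parameter reconstruction error satisfies $$\|\lambda_k-\lambda^\dagger\|_{L^2(\Omega)}^2\le C_\lambda^2\Big(\bar{\mathcal R}_\lambda^{(k)}+L_u\|u_k-u^\dagger\|_{H^2(\Omega)}^2\Big),$$ where $C_\lambda>0$ is a stability constant depending only on the domain $\Omega$, and $L_u>0$ is the Lipschitz coupling constant quantifying error propagation from the state variable.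
   Context: Setting. $\Omega\subset\mathbb R^d$ is a bounded domain with Lipschitz boundary. The governing problem is $-\nabla\cdot(q\nabla u)+bu=f$ in $\Omega$, $\mathcal Bu=g$ on $\partial\Omega$, where $q>0$, $b\ge 0$, and $\mathcal B$ is a linear boundary operator (Dirichlet or Neumann). The unknown $\lambda$ is either the source $f$ (inverse source problem; $q,b,g$ known) or the potential $b$ (inverse potential problem; $q,f,g$ known). The residual operator is $\mathcal N(u,\lambda)=-\nabla\cdot(q\nabla u)+bu-f$, with the unknown coefficient equal to $\lambda$. The exact pair $(u^\dagger,\lambda^\dagger)$ satisfies $\mathcal N(u^\dagger,\lambda^\dagger)=0$ in $\Omega$ and $\mathcal Bu^\dagger=g$ on $\partial\Omega$; the inverse problem is assumed to satisfy uniqueness and stability conditions. Observations. $\mathcal L_{obs}=\mathcal O_l(u^\dagger)+\epsilon$ on $\Omega$, where $\mathcal O_l$ is a linear observation operator and $\epsilon$ is noise of level $\delta_{noise}\ge0$, i.e. $\|\epsilon\|_{L^2(\Omega)}^2=\mathcal O(\delta_{noise}^2)$. Algorithm. Let $\omega_{\max}$ be the frequency band limit. Start from $u_0=0$, $\lambda_0=0$. At stage $k\ge1$: (i) $u_k=u_{k-1}+\phi_k$, where $\phi_k=\sum_{j=1}^{n_k}a_{k,j}^u\sin(\boldsymbol\omega_{k,j}^u\cdot\mathbf x+b_{k,j}^u)$, $|\boldsymbol\omega_{k,j}^u|\le\omega_{\max}$, is a width-$n_k$ network minimizing the stage-$k$ state loss $$\bar{\mathcal R}_u^{(k)}=\|\mathcal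 O_l(u_k)-\mathcal L_{obs}\|_{L^2(\Omega)}^2+\eta_1\|\mathcal Bu_k-g\|_{L^2(\partial\Omega)}^2+\eta_2\|\mathcal N(u_k,\lambda_{k-1})\|_{L^2(\Omega)}^2,$$ with weights $\eta_1,\eta_2>0$ (for $k=0$ the loss is evaluated at $u_0$, $\lambda_0$); (ii) $\lambda_k=\lambda_{k-1}+\psi_k$, where $\psi_k=\sum_{j=1}^{n_k}a_{k,j}^\lambda\sin(\boldsymbol\omega_{k,j}^\lambda\cdot\mathbf x+b_{k,j}^\lambda)$, $|\boldsymbol\omega_{k,j}^\lambda|\le\omega_{\max}$, is a width-$n_k$ network minimizing the stage-$k$ parameter loss $$\bar{\mathcal R}_\lambda^{(k)}=\|\mathcal N(u_k,\lambda_k)\|_{L^2(\Omega)}^2+\gamma_\lambda\sum_{j=1}^{n_k}\|\boldsymbol\omega_{k,j}^\lambda\|_2,$$ with $\gamma_\lambda\ge0$ a penalty coefficient. Lipschitz coupling constant. $L_u$ is a constant, uniform in $k$, with $\|\mathcal N(u_k,\lambda_k)-\mathcal N(u^\dagger,\lambda_k)\|_{L^2(\Omega)}^2\le L_u\|u_k-u^\dagger\|_{H^2(\Omega)}^2$ for all $k$.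
   Formalization: In the inverse potential problem the stability constant C_λ is allowed to depend on the lower bound c_0 of assumption (2) as well as on Ω, since no constant depending only on Ω works (scale u† toward zero); the estimate is stated for stages k≥1. *)

theory Defs
  imports "HOL-Analysis.Analysis" "HOL-Probability.Essential_Supremum" "HOL-Library.Multiset"
begin

section \<open>Bounded Lipschitz domains\<close>

text \<open>Near each boundary point the domain is the strict epigraph, in some direction \<open>n\<close>, of a
  Lipschitz function of the component orthogonal to \<open>n\<close>.\<close>

definition lipschitz_boundary :: "'a::euclidean_space set \<Rightarrow> bool" where
  "lipschitz_boundary \<Omega> \<longleftrightarrow>
     (\<forall>x\<in>frontier \<Omega>. \<exists>r>0. \<exists>n L. \<exists>h :: 'a \<Rightarrow> real.
        norm n = 1 \<and> L-lipschitz_on {z. z \<bullet> n = 0} h \<and>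
        \<Omega> \<inter> ball x r = {y \<in> ball x r. h (y - (y \<bullet> n) *\<^sub>R n) < y \<bullet> n})"

definition bounded_lipschitz_domain :: "'a::euclidean_space set \<Rightarrow> bool" where
  "bounded_lipschitz_domain \<Omega> \<longleftrightarrow>
     open \<Omega> \<and> connected \<Omega> \<and> \<Omega> \<noteq> {} \<and> bounded \<Omega> \<and> lipschitz_boundary \<Omega>"


section \<open>Square-integrable functions\<close>

text \<open>Squared norms are extended nonnegative reals, so that a function outside the space has norm
  \<open>\<infinity>\<close> and not the junk value \<open>0\<close> of the Bochner integral.\<close>

definition L2_norm_sq :: "'a measure \<Rightarrow> ('a \<Rightarrow> real) \<Rightarrow> ennreal" where
  "L2_norm_sq M f = (\<integral>\<^sup>+x. ennreal ((f x)\<^sup>2) \<partial>M)"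

definition square_integrable :: "'a measure \<Rightarrow> ('a \<Rightarrow> real) \<Rightarrow> bool" where
  "square_integrable M f \<longleftrightarrow> f \<in> borel_measurable M \<and> L2_norm_sq M f < \<infinity>"


section \<open>Weak derivatives and Sobolev norms\<close>

primrec iterated_partial :: "'a::euclidean_space list \<Rightarrow> ('a \<Rightarrow> real) \<Rightarrow> 'a \<Rightarrow> real" where
  "iterated_partial [] f = f"
| "iterated_partial (i # is) f = (\<lambda>x. frechet_derivative (iterated_partial is f) (at x) i)"

definition test_function :: "'a::euclidean_space set \<Rightarrow> ('a \<Rightarrow> real) \<Rightarrow> bool" where
  "test_function \<Omega> \<phi> \<longleftrightarrow>
     (\<forall>is\<in>lists Basis. \<forall>x. iterated_partial is \<phi> differentiable (at x)) \<and>
     compact (closure {x. \<phi> x \<noteq> 0}) \<and> closure {x. \<phi> x \<noteq> 0} \<subseteq> \<Omega>"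

definition locally_integrable :: "'a::euclidean_space set \<Rightarrow> ('a \<Rightarrow> real) \<Rightarrow> bool" where
  "locally_integrable \<Omega> f \<longleftrightarrow>
     f \<in> borel_measurable (lebesgue_on \<Omega>) \<and>
     (\<forall>K. compact K \<and> K \<subseteq> \<Omega> \<longrightarrow> set_integrable lebesgue K f)"

text \<open>A multi-index is a multiset of basis vectors; its order is the size of the multiset.\<close>

definition multi_indices :: "nat \<Rightarrow> 'a::euclidean_space multiset set" where
  "multi_indices m = {\<alpha>. set_mset \<alpha> \<subseteq> Basis \<and> size \<alpha> \<le> m}"

definition is_weak_deriv ::
  "'a::euclidean_space set \<Rightarrow> 'a multiset \<Rightarrow> ('a \<Rightarrow> real) \<Rightarrow> ('a \<Rightarrow> real) \<Rightarrow> bool" where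
  "is_weak_deriv \<Omega> \<alpha> u v \<longleftrightarrow>
     locally_integrable \<Omega> u \<and> locally_integrable \<Omega> v \<and>
     (\<forall>\<phi> is. test_function \<Omega> \<phi> \<and> mset is = \<alpha> \<longrightarrow>
        (\<integral>x. u x * iterated_partial is \<phi> x \<partial>lebesgue_on \<Omega>) =
        (-1) ^ size \<alpha> * (\<integral>x. v x * \<phi> x \<partial>lebesgue_on \<Omega>))"

definition weakly_differentiable ::
  "'a::euclidean_space set \<Rightarrow> 'a multiset \<Rightarrow> ('a \<Rightarrow> real) \<Rightarrow> bool" where
  "weakly_differentiable \<Omega> \<alpha> u \<longleftrightarrow> (\<exists>v. is_weak_deriv \<Omega> \<alpha> u v)"

text \<open>A representative of the weak derivative; the latter is unique up to null sets. The norms below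
  test existence separately, so the default \<open>0\<close> never makes a norm finite.\<close>

definition weak_deriv ::
  "'a::euclidean_space set \<Rightarrow> 'a multiset \<Rightarrow> ('a \<Rightarrow> real) \<Rightarrow> 'a \<Rightarrow> real" where
  "weak_deriv \<Omega> \<alpha> u =
     (if weakly_differentiable \<Omega> \<alpha> u then SOME v. is_weak_deriv \<Omega> \<alpha> u v else (\<lambda>_. 0))"

definition slobodeckij_seminorm_sq ::
  "'a::euclidean_space set \<Rightarrow> real \<Rightarrow> ('a \<Rightarrow> real) \<Rightarrow> ennreal" where
  "slobodeckij_seminorm_sq \<Omega> s v =
     (\<integral>\<^sup>+x. (\<integral>\<^sup>+y. ennreal ((v x - v y)\<^sup>2 / dist x y powr (real DIM('a) + 2 * s))
        \<partial>lebesgue_on \<Omega>) \<partial>lebesgue_on \<Omega>)"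

text \<open>The squared norm of \<open>H\<^sup>p(\<Omega>) = W\<^sup>p\<^sup>,\<^sup>2(\<Omega>)\<close> for real \<open>p \<ge> 0\<close>; for fractional \<open>p\<close> the
  Slobodeckij seminorms of the derivatives of order \<open>\<lfloor>p\<rfloor>\<close> are added.\<close>

definition H_norm_sq :: "'a::euclidean_space set \<Rightarrow> real \<Rightarrow> ('a \<Rightarrow> real) \<Rightarrow> ennreal" where
  "H_norm_sq \<Omega> p u =
     (if \<forall>\<alpha>\<in>multi_indices (nat \<lfloor>p\<rfloor>). weakly_differentiable \<Omega> \<alpha> u
      then (\<Sum>\<alpha>\<in>multi_indices (nat \<lfloor>p\<rfloor>). L2_norm_sq (lebesgue_on \<Omega>) (weak_deriv \<Omega> \<alpha> u)) +
           (if frac p = 0 then 0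
            else \<Sum>\<alpha>\<in>{\<alpha>\<in>multi_indices (nat \<lfloor>p\<rfloor>). size \<alpha> = nat \<lfloor>p\<rfloor>}.
                   slobodeckij_seminorm_sq \<Omega> (frac p) (weak_deriv \<Omega> \<alpha> u))
      else \<infinity>)"

definition H_space :: "'a::euclidean_space set \<Rightarrow> real \<Rightarrow> ('a \<Rightarrow> real) set" where
  "H_space \<Omega> p = {u. H_norm_sq \<Omega> p u < \<infinity>}"

definition H_norm :: "'a::euclidean_space set \<Rightarrow> real \<Rightarrow> ('a \<Rightarrow> real) \<Rightarrow> real" where
  "H_norm \<Omega> p u = sqrt (enn2real (H_norm_sq \<Omega> p u))"

definition W1inf_norm :: "'a::euclidean_space set \<Rightarrow> ('a \<Rightarrow> real) \<Rightarrow> ennreal" where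
  "W1inf_norm \<Omega> u =
     (if \<forall>\<alpha>\<in>multi_indices 1. weakly_differentiable \<Omega> \<alpha> u
      then SUP \<alpha>\<in>multi_indices 1. esssup (lebesgue_on \<Omega>) (\<lambda>x. ennreal \<bar>weak_deriv \<Omega> \<alpha> u x\<bar>)
      else \<infinity>)"


section \<open>Surface measure, traces and boundary operators\<close>

text \<open>Hausdorff measure, normalised to agree with Lebesgue measure in dimension \<open>s\<close>
  (counting measure for \<open>s = 0\<close>, whence the case distinction on \<open>U i = {}\<close>).\<close>

definition hausdorff_outer :: "nat \<Rightarrow> 'a::metric_space set \<Rightarrow> ennreal" where
  "hausdorff_outer s A =
     (SUP \<delta>\<in>{0<..}. INF U\<in>{U :: nat \<Rightarrow> 'a set.
          A \<subseteq> (\<Union>i. U i) \<and> (\<forall>i. bounded (U i) \<and> diameter (U i) \<le> \<delta>)}.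
        \<Sum>i. if U i = {} then 0
             else ennreal (unit_ball_vol (real s) * (diameter (U i) / 2) ^ s))"

definition hausdorff_measure :: "nat \<Rightarrow> 'a::metric_space measure" where
  "hausdorff_measure s = measure_of UNIV (sets borel) (hausdorff_outer s)"

definition surface_measure :: "'a::euclidean_space set \<Rightarrow> 'a measure" where
  "surface_measure \<Omega> = restrict_space (hausdorff_measure (DIM('a) - 1)) (frontier \<Omega>)"

text \<open>On a Lipschitz domain the Sobolev trace is, at almost every boundary point, the limit of
  averages over \<open>\<Omega> \<inter> ball x r\<close>; for functions continuous up to the boundary it is the
  boundary value.\<close>

definition trace :: "'a::euclidean_space set \<Rightarrow> ('a \<Rightarrow> real) \<Rightarrow> 'a \<Rightarrow> real" where
  "trace \<Omega> v x =
     Lim (at_right 0)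
       (\<lambda>r. (\<integral>y. v y \<partial>lebesgue_on (\<Omega> \<inter> ball x r)) / measure lebesgue (\<Omega> \<inter> ball x r))"

text \<open>At a point where the boundary graph is differentiable (almost every one, by Rademacher)
  this is the classical outward unit normal.\<close>

definition is_outward_normal :: "'a::euclidean_space set \<Rightarrow> 'a \<Rightarrow> 'a \<Rightarrow> bool" where
  "is_outward_normal \<Omega> x n \<longleftrightarrow> norm n = 1 \<and>
     (\<forall>e>0. \<exists>r>0. \<forall>y\<in>ball x r.
        ((y - x) \<bullet> n > e * norm (y - x) \<longrightarrow> y \<notin> \<Omega>) \<and>
        ((y - x) \<bullet> n < - e * norm (y - x) \<longrightarrow> y \<in> \<Omega>))"

definition outward_normal :: "'a::euclidean_space set \<Rightarrow> 'a \<Rightarrow> 'a" where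
  "outward_normal \<Omega> x = (SOME n. is_outward_normal \<Omega> x n)"

datatype boundary_condition = Dirichlet | Neumann

fun boundary_op ::
  "'a::euclidean_space set \<Rightarrow> boundary_condition \<Rightarrow> ('a \<Rightarrow> real) \<Rightarrow> 'a \<Rightarrow> real" where
  "boundary_op \<Omega> Dirichlet u x = trace \<Omega> u x"
| "boundary_op \<Omega> Neumann u x =
     (\<Sum>i\<in>Basis. trace \<Omega> (weak_deriv \<Omega> {#i#} u) x * (outward_normal \<Omega> x \<bullet> i))"


section \<open>The elliptic problem and its data\<close>

definition pde_residual ::
  "'a::euclidean_space set \<Rightarrow> ('a \<Rightarrow> real) \<Rightarrow> ('a \<Rightarrow> real) \<Rightarrow> ('a \<Rightarrow> real) \<Rightarrow> ('a \<Rightarrow> real) \<Rightarrow>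
     'a \<Rightarrow> real" where
  "pde_residual \<Omega> q b f u x =
     - (\<Sum>i\<in>Basis. weak_deriv \<Omega> {#i#} (\<lambda>y. q y * weak_deriv \<Omega> {#i#} u y) x) + b x * u x - f x"

text \<open>With \<open>q \<in> H\<^sup>1(\<Omega>)\<close> and the other coefficients in \<open>L\<^sup>2(\<Omega>)\<close>, the residual is a well-defined
  element of \<open>L\<^sup>2(\<Omega>)\<close> both at trigonometric networks and at the regular exact state.\<close>

definition diffusion_coefficient :: "'a::euclidean_space set \<Rightarrow> ('a \<Rightarrow> real) \<Rightarrow> bool" where
  "diffusion_coefficient \<Omega> q \<longleftrightarrow> q \<in> H_space \<Omega> 1 \<and> (AE x in lebesgue_on \<Omega>. 0 < q x)"

text \<open>In what follows \<open>N u l\<close> is the residual of the state \<open>u\<close> and the unknown coefficient \<open>l\<close>.\<close>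

definition exact_pair ::
  "'a::euclidean_space set \<Rightarrow> (('a \<Rightarrow> real) \<Rightarrow> ('a \<Rightarrow> real) \<Rightarrow> 'a \<Rightarrow> real) \<Rightarrow>
     boundary_condition \<Rightarrow> ('a \<Rightarrow> real) \<Rightarrow> ('a \<Rightarrow> real) \<Rightarrow> ('a \<Rightarrow> real) \<Rightarrow> bool" where
  "exact_pair \<Omega> N bc g u l \<longleftrightarrow>
     (AE x in lebesgue_on \<Omega>. N u l x = 0) \<and>
     (AE x in surface_measure \<Omega>. boundary_op \<Omega> bc u x = g x)"

text \<open>A linear map from \<open>H\<^sup>p(\<Omega>)\<close> to \<open>L\<^sup>2(\<Omega>)\<close>, acting on representatives.\<close>

definition linear_observation ::
  "'a::euclidean_space set \<Rightarrow> real \<Rightarrow> (('a \<Rightarrow> real) \<Rightarrow> 'a \<Rightarrow> real) \<Rightarrow> bool" where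
  "linear_observation \<Omega> p Obs \<longleftrightarrow>
     (\<forall>u\<in>H_space \<Omega> p. square_integrable (lebesgue_on \<Omega>) (Obs u)) \<and>
     (\<forall>u\<in>H_space \<Omega> p. \<forall>v\<in>H_space \<Omega> p.
        (AE x in lebesgue_on \<Omega>. u x = v x) \<longrightarrow> (AE x in lebesgue_on \<Omega>. Obs u x = Obs v x)) \<and>
     (\<forall>u\<in>H_space \<Omega> p. \<forall>v\<in>H_space \<Omega> p. \<forall>s t.
        AE x in lebesgue_on \<Omega>. Obs (\<lambda>y. s * u y + t * v y) x = s * Obs u x + t * Obs v x)"

definition noise_of_level :: "'a::euclidean_space set \<Rightarrow> real \<Rightarrow> ('a \<Rightarrow> real) \<Rightarrow> bool" where
  "noise_of_level \<Omega> \<delta> e \<longleftrightarrow>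
     0 \<le> \<delta> \<and> e \<in> borel_measurable (lebesgue_on \<Omega>) \<and>
     (\<exists>K. L2_norm_sq (lebesgue_on \<Omega>) e \<le> ennreal (K * \<delta>\<^sup>2))"


section \<open>The alternating algorithm\<close>

text \<open>The parameters \<open>(a, w, c)\<close> of each neuron \<open>x \<mapsto> a sin (w \<bullet> x + c)\<close>.\<close>

type_synonym 'a net = "nat \<Rightarrow> real \<times> 'a \<times> real"

definition sine_net :: "nat \<Rightarrow> 'a::euclidean_space net \<Rightarrow> 'a \<Rightarrow> real" where
  "sine_net n \<theta> x = (\<Sum>j<n. case \<theta> j of (a, w, c) \<Rightarrow> a * sin (w \<bullet> x + c))"

definition frequency :: "'a net \<Rightarrow> nat \<Rightarrow> 'a" where
  "frequency \<theta> j = fst (snd (\<theta> j))"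

definition band_limited :: "real \<Rightarrow> nat \<Rightarrow> 'a::euclidean_space net \<Rightarrow> bool" where
  "band_limited W n \<theta> \<longleftrightarrow> (\<forall>j<n. norm (frequency \<theta> j) \<le> W)"

definition state_loss ::
  "'a::euclidean_space set \<Rightarrow> (('a \<Rightarrow> real) \<Rightarrow> ('a \<Rightarrow> real) \<Rightarrow> 'a \<Rightarrow> real) \<Rightarrow>
     boundary_condition \<Rightarrow> ('a \<Rightarrow> real) \<Rightarrow> (('a \<Rightarrow> real) \<Rightarrow> 'a \<Rightarrow> real) \<Rightarrow> ('a \<Rightarrow> real) \<Rightarrow>
     real \<Rightarrow> real \<Rightarrow> ('a \<Rightarrow> real) \<Rightarrow> ('a \<Rightarrow> real) \<Rightarrow> ennreal" where
  "state_loss \<Omega> N bc g Obs Lobs \<eta>\<^sub>1 \<eta>\<^sub>2 u l =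
     L2_norm_sq (lebesgue_on \<Omega>) (\<lambda>x. Obs u x - Lobs x) +
     ennreal \<eta>\<^sub>1 * L2_norm_sq (surface_measure \<Omega>) (\<lambda>x. boundary_op \<Omega> bc u x - g x) +
     ennreal \<eta>\<^sub>2 * L2_norm_sq (lebesgue_on \<Omega>) (N u l)"

text \<open>Here \<open>\<theta>\<close> is the network by which the current stage has updated the coefficient \<open>l\<close>.\<close>

definition param_loss ::
  "'a::euclidean_space set \<Rightarrow> (('a \<Rightarrow> real) \<Rightarrow> ('a \<Rightarrow> real) \<Rightarrow> 'a \<Rightarrow> real) \<Rightarrow>
     real \<Rightarrow> nat \<Rightarrow> 'a net \<Rightarrow> ('a \<Rightarrow> real) \<Rightarrow> ('a \<Rightarrow> real) \<Rightarrow> ennreal" where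
  "param_loss \<Omega> N \<gamma> n \<theta> u l =
     L2_norm_sq (lebesgue_on \<Omega>) (N u l) + ennreal (\<gamma> * (\<Sum>j<n. norm (frequency \<theta> j)))"

definition alternating_iterates ::
  "'a::euclidean_space set \<Rightarrow> (('a \<Rightarrow> real) \<Rightarrow> ('a \<Rightarrow> real) \<Rightarrow> 'a \<Rightarrow> real) \<Rightarrow>
     boundary_condition \<Rightarrow> ('a \<Rightarrow> real) \<Rightarrow> (('a \<Rightarrow> real) \<Rightarrow> 'a \<Rightarrow> real) \<Rightarrow> ('a \<Rightarrow> real) \<Rightarrow>
     real \<Rightarrow> real \<Rightarrow> real \<Rightarrow> real \<Rightarrow> (nat \<Rightarrow> nat) \<Rightarrow> (nat \<Rightarrow> 'a net) \<Rightarrow> (nat \<Rightarrow> 'a net) \<Rightarrow>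
     (nat \<Rightarrow> 'a \<Rightarrow> real) \<Rightarrow> (nat \<Rightarrow> 'a \<Rightarrow> real) \<Rightarrow> bool" where
  "alternating_iterates \<Omega> N bc g Obs Lobs \<eta>\<^sub>1 \<eta>\<^sub>2 \<gamma> W n \<Phi> \<Psi> u l \<longleftrightarrow>
     u 0 = (\<lambda>_. 0) \<and> l 0 = (\<lambda>_. 0) \<and>
     (\<forall>k\<ge>1.
        band_limited W (n k) (\<Phi> k) \<and>
        u k = (\<lambda>x. u (k - 1) x + sine_net (n k) (\<Phi> k) x) \<and>
        (\<forall>\<theta>. band_limited W (n k) \<theta> \<longrightarrow>
           state_loss \<Omega> N bc g Obs Lobs \<eta>\<^sub>1 \<eta>\<^sub>2 (u k) (l (k - 1)) \<le>
           state_loss \<Omega> N bc g Obs Lobs \<eta>\<^sub>1 \<eta>\<^sub>2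
             (\<lambda>x. u (k - 1) x + sine_net (n k) \<theta> x) (l (k - 1))) \<and>
        band_limited W (n k) (\<Psi> k) \<and>
        l k = (\<lambda>x. l (k - 1) x + sine_net (n k) (\<Psi> k) x) \<and>
        (\<forall>\<theta>. band_limited W (n k) \<theta> \<longrightarrow>
           param_loss \<Omega> N \<gamma> (n k) (\<Psi> k) (u k) (l k) \<le>
           param_loss \<Omega> N \<gamma> (n k) \<theta> (u k)
             (\<lambda>x. l (k - 1) x + sine_net (n k) \<theta> x)))"

text \<open>The bounds \<open>Mu\<close>, \<open>Ml\<close> are functions of the band limit, the initial state loss and the norms
  of the exact state and of the exact coefficient in \<open>H\<^sup>p(\<Omega>)\<close>.\<close>

definition bounded_iterates ::
  "'a::euclidean_space set \<Rightarrow> (real \<Rightarrow> real \<Rightarrow> real \<Rightarrow> real \<Rightarrow> real) \<Rightarrow>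
     (real \<Rightarrow> real \<Rightarrow> real \<Rightarrow> real \<Rightarrow> real) \<Rightarrow> real \<Rightarrow> ennreal \<Rightarrow> real \<Rightarrow>
     ('a \<Rightarrow> real) \<Rightarrow> ('a \<Rightarrow> real) \<Rightarrow> (nat \<Rightarrow> 'a \<Rightarrow> real) \<Rightarrow> (nat \<Rightarrow> 'a \<Rightarrow> real) \<Rightarrow> bool" where
  "bounded_iterates \<Omega> Mu Ml W R0 p ud ld u l \<longleftrightarrow>
     0 < Mu W (enn2real R0) (H_norm \<Omega> p ud) (H_norm \<Omega> p ld) \<and>
     0 < Ml W (enn2real R0) (H_norm \<Omega> p ud) (H_norm \<Omega> p ld) \<and>
     (\<forall>k. W1inf_norm \<Omega> (u k) \<le> ennreal (Mu W (enn2real R0) (H_norm \<Omega> p ud) (H_norm \<Omega> p ld)) \<and>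
          W1inf_norm \<Omega> (l k) \<le> ennreal (Ml W (enn2real R0) (H_norm \<Omega> p ud) (H_norm \<Omega> p ld)))"

definition lipschitz_coupling ::
  "'a::euclidean_space set \<Rightarrow> (('a \<Rightarrow> real) \<Rightarrow> ('a \<Rightarrow> real) \<Rightarrow> 'a \<Rightarrow> real) \<Rightarrow>
     ('a \<Rightarrow> real) \<Rightarrow> (nat \<Rightarrow> 'a \<Rightarrow> real) \<Rightarrow> (nat \<Rightarrow> 'a \<Rightarrow> real) \<Rightarrow> real \<Rightarrow> bool" where
  "lipschitz_coupling \<Omega> N ud u l Lu \<longleftrightarrow>
     0 < Lu \<and>
     (\<forall>k. L2_norm_sq (lebesgue_on \<Omega>) (\<lambda>x. N (u k) (l k) x - N ud (l k) x)
          \<le> ennreal Lu * H_norm_sq \<Omega> 2 (\<lambda>x. u k x - ud x))"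

end

theory Submission
  imports Defs
begin

text \<open>By the exact equation, \<open>N(u\<^sup>\<dagger>, \<lambda>\<^sub>k) = N(u\<^sup>\<dagger>, \<lambda>\<^sub>k) - N(u\<^sup>\<dagger>, \<lambda>\<^sup>\<dagger>)\<close> is
  \<open>\<lambda>\<^sup>\<dagger> - \<lambda>\<^sub>k\<close> in the source problem and \<open>(\<lambda>\<^sub>k - \<lambda>\<^sup>\<dagger>) u\<^sup>\<dagger>\<close> in the potential problem, so that
  \<open>\<bar>N(u\<^sup>\<dagger>, \<lambda>\<^sub>k)\<bar>\<close> dominates \<open>c \<bar>\<lambda>\<^sub>k - \<lambda>\<^sup>\<dagger>\<bar>\<close> with \<open>c = 1\<close> or \<open>c = c\<^sub>0\<close>. The residual itself splits
  into \<open>N(u\<^sub>k, \<lambda>\<^sub>k)\<close>, controlled by the loss, minus \<open>N(u\<^sub>k, \<lambda>\<^sub>k) - N(u\<^sup>\<dagger>, \<lambda>\<^sub>k)\<close>, controlled by the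
  Lipschitz coupling.\<close>

lemma weakly_differentiable_imp_measurable:
  "weakly_differentiable \<Omega> \<alpha> u \<Longrightarrow> u \<in> borel_measurable (lebesgue_on \<Omega>)"
  by (auto simp: weakly_differentiable_def is_weak_deriv_def locally_integrable_def)

text \<open>Any weak derivative is locally integrable, hence measurable, and so is the default
  \<open>0\<close>; hence no differentiability has to be assumed.\<close>

lemma weak_deriv_measurable [measurable]:
  "weak_deriv \<Omega> \<alpha> u \<in> borel_measurable (lebesgue_on \<Omega>)"
proof (cases "weakly_differentiable \<Omega> \<alpha> u")
  case True
  then have "is_weak_deriv \<Omega> \<alpha> u (weak_deriv \<Omega> \<alpha> u)"
    using someI_ex[of "is_weak_deriv \<Omega> \<alpha> u"]
    by (simp add: weak_deriv_def weakly_differentiable_def)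
  then show ?thesis
    by (simp add: is_weak_deriv_def locally_integrable_def)
qed (simp add: weak_deriv_def)

lemma empty_in_multi_indices [simp]: "{#} \<in> multi_indices m"
  by (simp add: multi_indices_def)

text \<open>A finite norm excludes the branch \<open>\<infinity>\<close>, so weak differentiability
  holds for the empty multi-index too, and at order zero it contains the measurability of
  \<open>u\<close> itself.\<close>

lemma H_space_imp_measurable:
  "u \<in> H_space \<Omega> p \<Longrightarrow> u \<in> borel_measurable (lebesgue_on \<Omega>)"
  by (auto simp: H_space_def H_norm_sq_def split: if_splits
      intro: weakly_differentiable_imp_measurable[OF bspec[OF _ empty_in_multi_indices]])

lemma W1inf_bound_imp_measurable:
  "W1inf_norm \<Omega> u \<le> ennreal M \<Longrightarrow> u \<in> borel_measurable (lebesgue_on \<Omega>)"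
  by (auto simp: W1inf_norm_def top_unique split: if_splits
      intro: weakly_differentiable_imp_measurable[OF bspec[OF _ empty_in_multi_indices]])

text \<open>The diffusion term is a sum of chosen weak derivatives, which are always measurable;
  only the terms of order zero remain.\<close>

lemma pde_residual_measurable [measurable]:
  assumes [measurable]: "b \<in> borel_measurable (lebesgue_on \<Omega>)"
    "f \<in> borel_measurable (lebesgue_on \<Omega>)" "u \<in> borel_measurable (lebesgue_on \<Omega>)"
  shows "pde_residual \<Omega> q b f u \<in> borel_measurable (lebesgue_on \<Omega>)"
  unfolding pde_residual_def[abs_def] by measurable

text \<open>Measurability matters: on non-measurable functions the nonnegative integral is only
  superadditive.\<close>

lemma L2_norm_sq_le_of_abs_le_diff:
  fixes R D e :: "'a \<Rightarrow> real"
  assumes [measurable]: "R \<in> borel_measurable M" "D \<in> borel_measurable M"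
    and "0 < c" and "AE x in M. c * \<bar>e x\<bar> \<le> \<bar>R x - D x\<bar>"
  shows "L2_norm_sq M e \<le> ennreal ((sqrt 2 / c)\<^sup>2) * (L2_norm_sq M R + L2_norm_sq M D)"
proof -
  have pointwise: "(e x)\<^sup>2 \<le> (sqrt 2 / c)\<^sup>2 * ((R x)\<^sup>2 + (D x)\<^sup>2)"
    if "c * \<bar>e x\<bar> \<le> \<bar>R x - D x\<bar>" for x
  proof -
    have "c\<^sup>2 * (e x)\<^sup>2 = (c * \<bar>e x\<bar>)\<^sup>2"
      by (simp add: power_mult_distrib)
    also have "\<dots> \<le> (R x - D x)\<^sup>2"
      using power_mono[OF that, of 2] \<open>0 < c\<close> by simp
    \<comment> \<open>Parallelogram identity, with the square of \<open>R x + D x\<close> dropped.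
      This factor 2 is the source of \<open>sqrt 2\<close> in the constant.\<close>
    also have "\<dots> \<le> 2 * ((R x)\<^sup>2 + (D x)\<^sup>2)"
      using zero_le_power2[of "R x + D x"] by (simp add: power2_sum power2_diff)
    finally show ?thesis
      using \<open>0 < c\<close> by (simp add: field_simps power_divide)
  qed
  have "L2_norm_sq M e \<le> (\<integral>\<^sup>+x. ennreal ((sqrt 2 / c)\<^sup>2) * (ennreal ((R x)\<^sup>2) + ennreal ((D x)\<^sup>2)) \<partial>M)"
    unfolding L2_norm_sq_def
  proof (rule nn_integral_mono_AE)
    show "AE x in M. ennreal ((e x)\<^sup>2) \<le>
        ennreal ((sqrt 2 / c)\<^sup>2) * (ennreal ((R x)\<^sup>2) + ennreal ((D x)\<^sup>2))"
      using assms(4)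
    proof eventually_elim
      case (elim x)
      then show ?case
        using ennreal_leI[OF pointwise[OF elim]] by (simp add: ennreal_mult ennreal_plus)
    qed
  qed
  also have "\<dots> = ennreal ((sqrt 2 / c)\<^sup>2) * (L2_norm_sq M R + L2_norm_sq M D)"
    by (simp add: L2_norm_sq_def nn_integral_cmult nn_integral_add)
  finally show ?thesis .
qed

text \<open>The part common to both inverse problems: they differ only in how the pointwise
  stability estimate with constant \<open>c\<close> is obtained.\<close>

lemma coefficient_error_bound:
  assumes "N (u k) (l k) \<in> borel_measurable (lebesgue_on \<Omega>)"
    and "N ud (l k) \<in> borel_measurable (lebesgue_on \<Omega>)"
    and "0 < c" and "AE x in lebesgue_on \<Omega>. c * \<bar>l k x - ld x\<bar> \<le> \<bar>N ud (l k) x\<bar>"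
    and "lipschitz_coupling \<Omega> N ud u l Lu"
  shows "L2_norm_sq (lebesgue_on \<Omega>) (\<lambda>x. l k x - ld x)
    \<le> ennreal ((sqrt 2 / c)\<^sup>2) * (param_loss \<Omega> N \<gamma> n \<theta> (u k) (l k) +
        ennreal Lu * H_norm_sq \<Omega> 2 (\<lambda>x. u k x - ud x))"
proof -
  have "L2_norm_sq (lebesgue_on \<Omega>) (\<lambda>x. l k x - ld x) \<le> ennreal ((sqrt 2 / c)\<^sup>2) *
      (L2_norm_sq (lebesgue_on \<Omega>) (N (u k) (l k)) +
       L2_norm_sq (lebesgue_on \<Omega>) (\<lambda>x. N (u k) (l k) x - N ud (l k) x))"
    \<comment> \<open>With \<open>R\<close> the residual at the iterates and \<open>D\<close> the
      coupling difference, \<open>R x - D x\<close> collapses to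
      \<open>N ud (l k) x\<close>.\<close>
    using assms(1-4) by (intro L2_norm_sq_le_of_abs_le_diff) auto
  also have "\<dots> \<le> ennreal ((sqrt 2 / c)\<^sup>2) * (param_loss \<Omega> N \<gamma> n \<theta> (u k) (l k) +
      ennreal Lu * H_norm_sq \<Omega> 2 (\<lambda>x. u k x - ud x))"
    using assms(5)
    \<comment> \<open>The frequency penalty is an extended nonnegative real, so adding it only
      enlarges the bound.\<close>
    by (intro mult_left_mono add_mono) (auto simp: param_loss_def lipschitz_coupling_def)
  finally show ?thesis .
qed

text \<open>Measurability is read off from the finite norm bounds instead of from the form of the
  iterates as sums of sine networks.\<close>

lemma bounded_iterates_imp_measurable:
  assumes "bounded_iterates \<Omega> Mu Ml W R0 p ud ld u l"
  shows "u k \<in> borel_measurable (lebesgue_on \<Omega>)" "l k \<in> borel_measurable (lebesgue_on \<Omega>)"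
  using assms W1inf_bound_imp_measurable unfolding bounded_iterates_def by blast+

lemma source_error_bound:
  assumes "N = (\<lambda>v f. pde_residual \<Omega> q b f v)"
    and "square_integrable (lebesgue_on \<Omega>) b"
    and "ud \<in> H_space \<Omega> p" and "exact_pair \<Omega> N bc g ud ld"
    and "bounded_iterates \<Omega> Mu Ml W R0 p ud ld u l" and "lipschitz_coupling \<Omega> N ud u l Lu"
  shows "L2_norm_sq (lebesgue_on \<Omega>) (\<lambda>x. l k x - ld x)
    \<le> ennreal ((sqrt 2)\<^sup>2) * (param_loss \<Omega> N \<gamma> n \<theta> (u k) (l k) +
        ennreal Lu * H_norm_sq \<Omega> 2 (\<lambda>x. u k x - ud x))"
proof -
  note [measurable] = bounded_iterates_imp_measurable[OF assms(5)] H_space_imp_measurable[OF assms(3)]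
  have [measurable]: "b \<in> borel_measurable (lebesgue_on \<Omega>)"
    using assms(2) by (simp add: square_integrable_def)
  have exact: "AE x in lebesgue_on \<Omega>. N ud ld x = 0"
    using assms(4) by (simp add: exact_pair_def)
  \<comment> \<open>The source enters the residual with coefficient -1, so this is an equality; the
    factor 1 matches the form with \<open>c\<close>.\<close>
  have stable: "AE x in lebesgue_on \<Omega>. 1 * \<bar>l k x - ld x\<bar> \<le> \<bar>N ud (l k) x\<bar>"
    using exact by eventually_elim (simp add: assms(1) pde_residual_def)
  show ?thesis
    using coefficient_error_bound[OF _ _ _ stable assms(6)] by (simp add: assms(1))
qed

lemma potential_error_bound:
  assumes "N = (\<lambda>v b. pde_residual \<Omega> q b f v)"
    and "square_integrable (lebesgue_on \<Omega>) f"
    and "ud \<in> H_space \<Omega> p" and "exact_pair \<Omega> N bc g ud ld"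
    and "0 < c" and "AE x in lebesgue_on \<Omega>. c \<le> \<bar>ud x\<bar>"
    and "bounded_iterates \<Omega> Mu Ml W R0 p ud ld u l" and "lipschitz_coupling \<Omega> N ud u l Lu"
  shows "L2_norm_sq (lebesgue_on \<Omega>) (\<lambda>x. l k x - ld x)
    \<le> ennreal ((sqrt 2 / c)\<^sup>2) * (param_loss \<Omega> N \<gamma> n \<theta> (u k) (l k) +
        ennreal Lu * H_norm_sq \<Omega> 2 (\<lambda>x. u k x - ud x))"
proof -
  note [measurable] = bounded_iterates_imp_measurable[OF assms(7)] H_space_imp_measurable[OF assms(3)]
  have [measurable]: "f \<in> borel_measurable (lebesgue_on \<Omega>)"
    using assms(2) by (simp add: square_integrable_def)
  have exact: "AE x in lebesgue_on \<Omega>. N ud ld x = 0"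
    using assms(4) by (simp add: exact_pair_def)
  have stable: "AE x in lebesgue_on \<Omega>. c * \<bar>l k x - ld x\<bar> \<le> \<bar>N ud (l k) x\<bar>"
    using exact assms(6)
  proof eventually_elim
    case (elim x)
    have "N ud (l k) x = N ud (l k) x - N ud ld x"
      using elim by simp
    \<comment> \<open>Diffusion term and source are common to both residuals and cancel; the lower
      bound on the modulus of \<open>ud\<close> then controls the remaining factor.\<close>
    also have "\<dots> = ud x * (l k x - ld x)"
      by (simp add: assms(1) pde_residual_def algebra_simps)
    finally show ?case
      using elim by (simp add: abs_mult mult_right_mono)
  qed
  show ?thesis
    using coefficient_error_bound[OF _ _ assms(5) stable assms(8)] by (simp add: assms(1))
qed

theorem theorem2:
  fixes \<Omega> :: "'a::euclidean_space set"
  assumes "bounded_lipschitz_domain \<Omega>"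
  shows
    "(\<comment> \<open>inverse source problem: \<open>f\<close> is the unknown\<close>
      \<exists>C>0. \<forall>Mu Ml p q b bc g Obs \<epsilon> \<delta> Lobs \<eta>\<^sub>1 \<eta>\<^sub>2 \<gamma> \<omega>max n \<Phi> \<Psi> u l ud ld Lu N.
         N = (\<lambda>v f. pde_residual \<Omega> q b f v) \<and>
         diffusion_coefficient \<Omega> q \<and>
         square_integrable (lebesgue_on \<Omega>) b \<and> (AE x in lebesgue_on \<Omega>. 0 \<le> b x) \<and>
         square_integrable (surface_measure \<Omega>) g \<and>
         p > max (real DIM('a) / 2 + 1) 4 \<and> ud \<in> H_space \<Omega> p \<and> ld \<in> H_space \<Omega> p \<and>
         exact_pair \<Omega> N bc g ud ld \<and>
         linear_observation \<Omega> p Obs \<and> noise_of_level \<Omega> \<delta> \<epsilon> \<and>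
         Lobs = (\<lambda>x. Obs ud x + \<epsilon> x) \<and>
         0 < \<eta>\<^sub>1 \<and> 0 < \<eta>\<^sub>2 \<and> 0 \<le> \<gamma> \<and> 0 < \<omega>max \<and>
         alternating_iterates \<Omega> N bc g Obs Lobs \<eta>\<^sub>1 \<eta>\<^sub>2 \<gamma> \<omega>max n \<Phi> \<Psi> u l \<and>
         bounded_iterates \<Omega> Mu Ml \<omega>max (state_loss \<Omega> N bc g Obs Lobs \<eta>\<^sub>1 \<eta>\<^sub>2 (u 0) (l 0))
           p ud ld u l \<and>
         lipschitz_coupling \<Omega> N ud u l Lu
         \<longrightarrow> (\<forall>k\<ge>1. L2_norm_sq (lebesgue_on \<Omega>) (\<lambda>x. l k x - ld x)
                \<le> ennreal (C\<^sup>2) * (param_loss \<Omega> N \<gamma> (n k) (\<Psi> k) (u k) (l k) +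
                                   ennreal Lu * H_norm_sq \<Omega> 2 (\<lambda>x. u k x - ud x)))) \<and>
     (\<comment> \<open>inverse potential problem: \<open>b\<close> is the unknown\<close>
      \<forall>c\<^sub>0>0. \<exists>C>0. \<forall>Mu Ml p q f bc g Obs \<epsilon> \<delta> Lobs \<eta>\<^sub>1 \<eta>\<^sub>2 \<gamma> \<omega>max n \<Phi> \<Psi> u l ud ld Lu N.
         N = (\<lambda>v b. pde_residual \<Omega> q b f v) \<and>
         diffusion_coefficient \<Omega> q \<and>
         square_integrable (lebesgue_on \<Omega>) f \<and> (AE x in lebesgue_on \<Omega>. 0 \<le> ld x) \<and>
         square_integrable (surface_measure \<Omega>) g \<and>
         p > max (real DIM('a) / 2 + 1) 4 \<and> ud \<in> H_space \<Omega> p \<and> ld \<in> H_space \<Omega> p \<and>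
         exact_pair \<Omega> N bc g ud ld \<and>
         (AE x in lebesgue_on \<Omega>. c\<^sub>0 \<le> \<bar>ud x\<bar>) \<and>
         linear_observation \<Omega> p Obs \<and> noise_of_level \<Omega> \<delta> \<epsilon> \<and>
         Lobs = (\<lambda>x. Obs ud x + \<epsilon> x) \<and>
         0 < \<eta>\<^sub>1 \<and> 0 < \<eta>\<^sub>2 \<and> 0 \<le> \<gamma> \<and> 0 < \<omega>max \<and>
         alternating_iterates \<Omega> N bc g Obs Lobs \<eta>\<^sub>1 \<eta>\<^sub>2 \<gamma> \<omega>max n \<Phi> \<Psi> u l \<and>
         bounded_iterates \<Omega> Mu Ml \<omega>max (state_loss \<Omega> N bc g Obs Lobs \<eta>\<^sub>1 \<eta>\<^sub>2 (u 0) (l 0))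
           p ud ld u l \<and>
         lipschitz_coupling \<Omega> N ud u l Lu
         \<longrightarrow> (\<forall>k\<ge>1. L2_norm_sq (lebesgue_on \<Omega>) (\<lambda>x. l k x - ld x)
                \<le> ennreal (C\<^sup>2) * (param_loss \<Omega> N \<gamma> (n k) (\<Psi> k) (u k) (l k) +
                                   ennreal Lu * H_norm_sq \<Omega> 2 (\<lambda>x. u k x - ud x))))"
proof (intro conjI allI impI, goal_cases)
  case 1
  \<comment> \<open>An absolute constant works here, since the stability constant is 1.\<close>
  show ?case
    by (intro exI[of _ "sqrt 2"] conjI allI impI; (elim conjE)?)
      (simp, rule source_error_bound)
next
  case (2 c\<^sub>0)
  \<comment> \<open>The witness depends on \<open>c\<^sub>0\<close> alone, which is fixed before all
    other data.\<close>
  then show ?case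
    by (intro exI[of _ "sqrt 2 / c\<^sub>0"] conjI allI impI; (elim conjE)?)
      (simp, rule potential_error_bound)
qed

end
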